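(* Fix $l\ge 1$, $i\in\{1,\dots,n_c\}$, a vector $z_{l-1}=(x_0,u_0,\dots,u_{l-1})\in\mathbb{R}^{d_l}$ with $d_l=n+ml$, a vector $\Delta u_l\in\mathbb{R}^m$, and an integer $q\ge 1$ (the Bernstein degree). Suppose that (i) $\hat\psi^{\rm ns}_{l,i}:[0,1]\to\mathbb{R}^m$ is $L^{\rm ns}_{l,i}$-smooth, and (ii) $\psi^{\rm sm}_{l,i}:[0,1]\to\mathbb{R}^{d_l}$ is $L^{\rm sm}_{l,i}$-smooth. Let $K^{\rm sm}_{l,i}$ be a Lipschitz constant of $\psi^{\rm sm}_{l,i}$ on $[0,1]$. Then, for the uniform partition of $[0,1]$ into $N_s\ge 1$ subintervals, with $\mathrm{gap}_{N_s}$ as defined in the context, one has $\mathrm{gap}_{N_s}\ge 0$ and $$\mathrm{gap}_{N_s}\le\left(\frac{K^{\rm sm}_{l,i}}{N_s}+\frac{L^{\rm sm}_{l,i}}{8qN_s^2}\right)\|z_{l-1}\|_*+\frac{L^{\rm ns}_{l,i}\,\|\Delta u_l\|_*}{8qN_s^{2\alpha}}.$$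
   Context: Data: $\alpha\in(0,1]$, $h>0$, $A\in\mathbb{R}^{n\times n}$, $B\in\mathbb{R}^{n\times m}$, $H\in\mathbb{R}^{n_c\times n}$ with $i$-th row $H_i$. Mittag-Leffler functions: for a square matrix $Z$, $E_{\alpha,\beta}(Z)=\sum_{j=0}^\infty \frac{Z^j}{\Gamma(\alpha j+\beta)}$ and $E_\alpha=E_{\alpha,1}$. Write $(a)_+=\max\{0,a\}$. For $\rho\ge 0$ let $G(\rho)=\rho E_{\alpha,\alpha+1}(A\rho)$, and for $t\ge0$ let $\mu(t)=E_\alpha(At^\alpha)$ and $\sigma_k(t)=G((t-kh)_+^\alpha)-G((t-(k+1)h)_+^\alpha)$ for $k=0,1,\ldots$ (These describe the response $x(t)=\mu(t)x_0+\sum_{k=0}^{\lfloor t/h\rfloor}\sigma_k(t)Bu_k$ of the Caputo fractional system $\mathrm{D}^\alpha x=Ax+Bu$ with zero-order-hold input $u(t)=u_k$ on $[kh,(k+1)h)$. For $t=h(l+\tau)$, $\tau\in[0,1]$, $l\ge1$, it equals $x(t)=S_l(\tau)z_{l-1}+G(h^\alpha\tau^\alpha)B\,\Delta u_l$ with $\Delta u_l=u_l-u_{l-1}$ and $S_l$ as below.) For $l\ge 1$ and $\tau\in[0,1]$, with $t=h(l+\tau)$, define the $n\times d_l$ matrix $$S_l(\tau)=\big[\mu(t)\;\;\sigma_0(t)B\;\;\cdots\;\;\sigma_{l-2}(t)B\;\;G(h^\alpha(1+\tau)^\alpha)B\big]$$ (for $l=1$ there are no $\sigma$ blocks), and $$\psi^{\rm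 sm}_{l,i}(\tau)=(H_iS_l(\tau))^\top,\qquad \psi^{\rm ns}_{l,i}(\tau)=(H_iG(h^\alpha\tau^\alpha)B)^\top,\qquad \hat\psi^{\rm ns}_{l,i}(\rho)=(H_iG(h^\alpha\rho)B)^\top\ (\rho\in[0,1]),$$ so that $\psi^{\rm ns}_{l,i}(\tau)=\hat\psi^{\rm ns}_{l,i}(\tau^\alpha)$. Norms: fix norms $\|\cdot\|$ on $\mathbb{R}^{d_l}$ and $\mathbb{R}^m$; all Lipschitz and smoothness constants refer to them, and $\|\cdot\|_*$ denotes the corresponding dual norm. A function $f:[0,1]\to X$ into a normed space is $L$-smooth if it is differentiable (one-sidedly at endpoints) and $\|f'(x)-f'(y)\|\le L|x-y|$ for all $x,y\in[0,1]$. Exact left-hand side: $$M=\sup_{\tau\in[0,1]}\{\psi^{\rm sm}_{l,i}(\tau)^\top z_{l-1}+\psi^{\rm ns}_{l,i}(\tau)^\top\Delta u_l\}.$$ Local enclosures: for $r=0,\dots,N_s-1$ let $J_r=[r/N_s,(r+1)/N_s]$, $\rho_r=(r/N_s)^\alpha$, and for $\nu=0,\dots,q$ let $$s^\nu_{l,i,r}=\psi^{\rm sm}_{l,i}\!\left(\tfrac{r+\nu/q}{N_s}\right),\qquad n^\nu_{l,i,r}=\hat\psi^{\rm ns}_{l,i}\!\left(\rho_r+\tfrac{\nu}{q}(\rho_{r+1}-\rho_r)\right).$$ The radii are $\eta^{\rm sm}_{l,i,r}=\frac{L^{\rm sm}_{l,i,r}}{8q}$ and $\eta^{\rm ns}_{l,i,r}=\frac{L^{\rm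 ns}_{l,i,r}}{8q}$, where $L^{\rm sm}_{l,i,r}$ and $L^{\rm ns}_{l,i,r}$ are smoothness constants on $[0,1]$ of the normalized local maps $\tau\mapsto\psi^{\rm sm}_{l,i}((r+\tau)/N_s)$ and $\theta\mapsto\hat\psi^{\rm ns}_{l,i}(\rho_r+\theta(\rho_{r+1}-\rho_r))$, respectively, chosen no larger than the constants inherited by scaling: $L^{\rm sm}_{l,i,r}\le L^{\rm sm}_{l,i}/N_s^2$ and $L^{\rm ns}_{l,i,r}\le L^{\rm ns}_{l,i}(\rho_{r+1}-\rho_r)^2$. Define $$B_r=\max_{\nu=0,\dots,q}(s^\nu_{l,i,r})^\top z_{l-1}+\eta^{\rm sm}_{l,i,r}\|z_{l-1}\|_*+\max_{\nu=0,\dots,q}(n^\nu_{l,i,r})^\top\Delta u_l+\eta^{\rm ns}_{l,i,r}\|\Delta u_l\|_*,$$ $$\mathrm{gap}_{N_s}=\max_{r=0,\dots,N_s-1}B_r-M.$$ *)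

theory Defs
  imports "HOL-Analysis.Analysis"
begin

text \<open>Arbitrary norms on a finite-dimensional space, as opposed to the norm that comes with
  the type, and their dual norms with respect to the standard pairing.\<close>

definition is_norm :: "('a::real_vector \<Rightarrow> real) \<Rightarrow> bool" where
  "is_norm N \<longleftrightarrow>
     (\<forall>x. 0 \<le> N x) \<and> (\<forall>x. N x = 0 \<longleftrightarrow> x = 0) \<and>
     (\<forall>c x. N (c *\<^sub>R x) = \<bar>c\<bar> * N x) \<and> (\<forall>x y. N (x + y) \<le> N x + N y)"

definition dual_norm :: "('a::real_inner \<Rightarrow> real) \<Rightarrow> 'a \<Rightarrow> real" where
  "dual_norm N z = (SUP x\<in>{x. N x \<le> 1}. x \<bullet> z)"

text \<open>Differentiability does not depend on the norm in finite dimension, so only the estimate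
  on the derivative mentions N. At 0 and 1 the derivative within the interval is one-sided.\<close>

definition smooth_const :: "('a::euclidean_space \<Rightarrow> real) \<Rightarrow> real \<Rightarrow> (real \<Rightarrow> 'a) \<Rightarrow> bool" where
  "smooth_const N L f \<longleftrightarrow>
     (\<exists>f'. (\<forall>x\<in>{0..1}. (f has_vector_derivative f' x) (at x within {0..1})) \<and>
           (\<forall>x\<in>{0..1}. \<forall>y\<in>{0..1}. N (f' x - f' y) \<le> L * \<bar>x - y\<bar>))"

definition lipschitz_const :: "('a::real_vector \<Rightarrow> real) \<Rightarrow> real \<Rightarrow> (real \<Rightarrow> 'a) \<Rightarrow> bool" where
  "lipschitz_const N K f \<longleftrightarrow> (\<forall>x\<in>{0..1}. \<forall>y\<in>{0..1}. N (f x - f y) \<le> K * \<bar>x - y\<bar>)"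

text \<open>The power of the type class on vectors of vectors is componentwise, hence an own matrix
  power.\<close>

definition matpow :: "real^'n^'n \<Rightarrow> nat \<Rightarrow> real^'n^'n" where
  "matpow Z j = (((**) Z) ^^ j) (mat 1)"

definition mittag_leffler :: "real \<Rightarrow> real \<Rightarrow> real^'n^'n \<Rightarrow> real^'n^'n" where
  "mittag_leffler \<alpha> \<beta> Z = (\<Sum>j. (1 / Gamma (\<alpha> * real j + \<beta>)) *\<^sub>R matpow Z j)"

definition G_mat :: "real \<Rightarrow> real^'n^'n \<Rightarrow> real \<Rightarrow> real^'n^'n" where
  "G_mat \<alpha> A \<rho> = \<rho> *\<^sub>R mittag_leffler \<alpha> (\<alpha> + 1) (\<rho> *\<^sub>R A)"

definition mu_mat :: "real \<Rightarrow> real^'n^'n \<Rightarrow> real \<Rightarrow> real^'n^'n" where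
  "mu_mat \<alpha> A t = mittag_leffler \<alpha> 1 ((t powr \<alpha>) *\<^sub>R A)"

definition sigma_mat :: "real \<Rightarrow> real \<Rightarrow> real^'n^'n \<Rightarrow> nat \<Rightarrow> real \<Rightarrow> real^'n^'n" where
  "sigma_mat \<alpha> h A k t =
     G_mat \<alpha> A (max 0 (t - real k * h) powr \<alpha>) -
     G_mat \<alpha> A (max 0 (t - real (k + 1) * h) powr \<alpha>)"

text \<open>The number l of input blocks is \<open>CARD('l)\<close>, and the coordinates of the space of
  dimension \<open>d = n + m * l\<close> are indexed by \<open>'n + 'l \<times> 'm\<close>: \<open>Inl j\<close> is the j-th coordinate of
  the initial state, \<open>Inr (b, j)\<close> the j-th coordinate of the input in block b. The blocks are
  numbered from 0 to l - 1 in the order of \<open>'l\<close>. Every \<open>l \<ge> 1\<close> is covered, for instance by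
  the numeral type with l elements.\<close>

definition block_pos :: "'l::{finite,linorder} \<Rightarrow> nat" where
  "block_pos b = card {..<b}"

definition S_mat ::
  "real \<Rightarrow> real \<Rightarrow> real^'n^'n \<Rightarrow> real^'m^'n \<Rightarrow> real
     \<Rightarrow> real^('n + 'l::{finite,linorder} \<times> 'm)^'n" where
  "S_mat \<alpha> h A B \<tau> =
     (let l = CARD('l); t = h * (real l + \<tau>) in
      \<chi> p c. case c of
          Inl j \<Rightarrow> mu_mat \<alpha> A t $ p $ j
        | Inr (b, j) \<Rightarrow>
            (if block_pos b < l - 1 then sigma_mat \<alpha> h A (block_pos b) t ** B
             else G_mat \<alpha> A (h powr \<alpha> * (1 + \<tau>) powr \<alpha>) ** B) $ p $ j)"

definition psi_sm ::
  "real \<Rightarrow> real \<Rightarrow> real^'n^'n \<Rightarrow> real^'m^'n \<Rightarrow> real^'n^'c \<Rightarrow> 'c \<Rightarrow> real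
     \<Rightarrow> real^('n + 'l::{finite,linorder} \<times> 'm)" where
  "psi_sm \<alpha> h A B H i \<tau> = row i H v* S_mat \<alpha> h A B \<tau>"

definition psi_ns ::
  "real \<Rightarrow> real \<Rightarrow> real^'n^'n \<Rightarrow> real^'m^'n \<Rightarrow> real^'n^'c \<Rightarrow> 'c \<Rightarrow> real \<Rightarrow> real^'m" where
  "psi_ns \<alpha> h A B H i \<tau> = row i H v* (G_mat \<alpha> A (h powr \<alpha> * \<tau> powr \<alpha>) ** B)"

definition psi_ns_hat ::
  "real \<Rightarrow> real \<Rightarrow> real^'n^'n \<Rightarrow> real^'m^'n \<Rightarrow> real^'n^'c \<Rightarrow> 'c \<Rightarrow> real \<Rightarrow> real^'m" where
  "psi_ns_hat \<alpha> h A B H i \<rho> = row i H v* (G_mat \<alpha> A (h powr \<alpha> * \<rho>) ** B)"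

definition rho :: "real \<Rightarrow> nat \<Rightarrow> nat \<Rightarrow> real" where
  "rho \<alpha> Ns r = (real r / real Ns) powr \<alpha>"

definition local_map_sm :: "nat \<Rightarrow> (real \<Rightarrow> 'a) \<Rightarrow> nat \<Rightarrow> real \<Rightarrow> 'a" where
  "local_map_sm Ns f r \<tau> = f ((real r + \<tau>) / real Ns)"

definition local_map_ns :: "real \<Rightarrow> nat \<Rightarrow> (real \<Rightarrow> 'a) \<Rightarrow> nat \<Rightarrow> real \<Rightarrow> 'a" where
  "local_map_ns \<alpha> Ns g r \<theta> = g (rho \<alpha> Ns r + \<theta> * (rho \<alpha> Ns (r + 1) - rho \<alpha> Ns r))"

definition exact_lhs ::
  "(real \<Rightarrow> 'a::real_inner) \<Rightarrow> (real \<Rightarrow> 'b::real_inner) \<Rightarrow> 'a \<Rightarrow> 'b \<Rightarrow> real" where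
  "exact_lhs fsm fns z \<Delta>u = (SUP \<tau>\<in>{0..1}. fsm \<tau> \<bullet> z + fns \<tau> \<bullet> \<Delta>u)"

text \<open>Here fsm and gns stand for \<open>psi_sm\<close> and \<open>psi_ns_hat\<close> with their data, and Lsm and Lns are
  the families of local smoothness constants, indexed by the subinterval.\<close>

definition local_bound ::
  "real \<Rightarrow> nat \<Rightarrow> nat \<Rightarrow> ('a::euclidean_space \<Rightarrow> real) \<Rightarrow> ('b::euclidean_space \<Rightarrow> real)
     \<Rightarrow> (real \<Rightarrow> 'a) \<Rightarrow> (real \<Rightarrow> 'b) \<Rightarrow> (nat \<Rightarrow> real) \<Rightarrow> (nat \<Rightarrow> real) \<Rightarrow> 'a \<Rightarrow> 'b
     \<Rightarrow> nat \<Rightarrow> real" where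
  "local_bound \<alpha> q Ns Nz Nu fsm gns Lsm Lns z \<Delta>u r =
     Max ((\<lambda>\<nu>. local_map_sm Ns fsm r (real \<nu> / real q) \<bullet> z) ` {0..q})
     + Lsm r / (8 * real q) * dual_norm Nz z
     + Max ((\<lambda>\<nu>. local_map_ns \<alpha> Ns gns r (real \<nu> / real q) \<bullet> \<Delta>u) ` {0..q})
     + Lns r / (8 * real q) * dual_norm Nu \<Delta>u"

definition gap ::
  "real \<Rightarrow> nat \<Rightarrow> nat \<Rightarrow> ('a::euclidean_space \<Rightarrow> real) \<Rightarrow> ('b::euclidean_space \<Rightarrow> real)
     \<Rightarrow> (real \<Rightarrow> 'a) \<Rightarrow> (real \<Rightarrow> 'b) \<Rightarrow> (real \<Rightarrow> 'b) \<Rightarrow> (nat \<Rightarrow> real) \<Rightarrow> (nat \<Rightarrow> real)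
     \<Rightarrow> 'a \<Rightarrow> 'b \<Rightarrow> real" where
  "gap \<alpha> q Ns Nz Nu fsm fns gns Lsm Lns z \<Delta>u =
     Max (local_bound \<alpha> q Ns Nz Nu fsm gns Lsm Lns z \<Delta>u ` {0..<Ns}) - exact_lhs fsm fns z \<Delta>u"

end

theory Submission
  imports Defs
begin

text \<open>Between two adjacent sample points, a real function with an \<open>L\<close>-Lipschitz derivative exceeds
  the larger of its values there by at most \<open>L / 8\<close> times the square of their distance: this is
  the interpolation error of the chord (\<open>smooth_le_chord\<close>). With sample points \<open>\<nu> / q\<close> the excess
  is at most \<open>L / (8 q\<^sup>2)\<close>, hence at most the radius \<open>L / (8 q)\<close> (\<open>smooth_const_le_Max\<close>), and the
  pairing with a vector costs its dual norm (\<open>inner_le_dual_norm\<close>). As the subintervals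
  \<open>J\<^sub>r\<close> cover \<open>[0, 1]\<close> and \<open>\<tau> \<mapsto> \<tau>\<^sup>\<alpha>\<close> maps \<open>J\<^sub>r\<close> onto \<open>[\<rho>\<^sub>r, \<rho>\<^sub>r\<^sub>+\<^sub>1]\<close>, the bounds \<open>B\<^sub>r\<close> dominate the
  exact left-hand side (\<open>value_le_local_bound\<close>), so the gap is nonnegative.

  For the upper estimate with \<open>N\<close> subintervals, let \<open>\<tau>\<close> be the point of \<open>J\<^sub>r\<close> where the nonsmooth part attains its sampled
  maximum. The smooth part attains its own at another point of \<open>J\<^sub>r\<close>, and the Lipschitz constant
  pays \<open>K / N\<close> for moving to \<open>\<tau>\<close>. Thus both sampled maxima together exceed a single value of the
  objective by no more than that (\<open>local_bound_le\<close>), and the radii supply the rest: the smooth one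
  scales like \<open>1 / N\<^sup>2\<close>, the nonsmooth one like \<open>(\<rho>\<^sub>r\<^sub>+\<^sub>1 - \<rho>\<^sub>r)\<^sup>2 \<le> N powr (- 2 \<alpha>)\<close>, because
  \<open>x \<mapsto> x\<^sup>\<alpha>\<close> is subadditive for \<open>\<alpha> \<le> 1\<close>. For the Mittag-Leffler maps
  the link between both parametrizations is that \<open>psi_ns\<close> at \<open>\<tau>\<close> is \<open>psi_ns_hat\<close> at \<open>\<tau>\<^sup>\<alpha>\<close>
  (\<open>gap_bounds\<close>).\<close>

section \<open>Dual norms\<close>

lemma is_norm_zero: "is_norm N \<Longrightarrow> N 0 = 0"
  unfolding is_norm_def by blast

text \<open>The constant is the minimum of \<open>N\<close> over the compact Euclidean unit sphere, where \<open>N\<close> is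
  continuous and positive.\<close>

lemma is_norm_lower_bound:
  fixes N :: "'a::euclidean_space \<Rightarrow> real"
  assumes "is_norm N"
  obtains c where "0 < c" "\<And>x. c * norm x \<le> N x"
proof -
  have nonneg: "0 \<le> N x" and zero: "N x = 0 \<longleftrightarrow> x = 0"
    and scale: "N (a *\<^sub>R x) = \<bar>a\<bar> * N x" and triangle: "N (x + y) \<le> N x + N y" for a x y
    using assms by (auto simp: is_norm_def)
  define C where "C = (\<Sum>b\<in>Basis. N b)"
  have upper: "N x \<le> C * norm x" for x
  proof -
    have sum_triangle: "N (\<Sum>b\<in>F. g b) \<le> (\<Sum>b\<in>F. N (g b))" if "finite F" for F and g :: "'a \<Rightarrow> 'a"
      using that
    proof (induction F)
      case empty
      then show ?case using zero[of 0] by simp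
    next
      case (insert b F)
      then show ?case using triangle[of "g b" "\<Sum>b\<in>F. g b"] by simp
    qed
    have "N x = N (\<Sum>b\<in>Basis. (x \<bullet> b) *\<^sub>R b)"
      by (simp add: euclidean_representation)
    also have "\<dots> \<le> (\<Sum>b\<in>Basis. \<bar>x \<bullet> b\<bar> * N b)"
      using sum_triangle[of Basis "\<lambda>b. (x \<bullet> b) *\<^sub>R b"] by (simp add: scale)
    also have "\<dots> \<le> (\<Sum>b\<in>Basis. norm x * N b)"
      by (intro sum_mono mult_right_mono Basis_le_norm nonneg)
    finally show ?thesis
      by (simp add: C_def sum_distrib_left mult.commute)
  qed
  have diff: "N x - N y \<le> C * dist x y" for x y
    using triangle[of "x - y" y] upper[of "x - y"] by (simp add: dist_norm)
  have "C-lipschitz_on UNIV N"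
  proof (rule lipschitz_onI)
    show "dist (N x) (N y) \<le> C * dist x y" for x y
      using diff[of x y] diff[of y x] by (simp add: dist_real_def dist_commute)
    show "0 \<le> C" by (simp add: C_def sum_nonneg nonneg)
  qed
  then have cont: "continuous_on (sphere 0 1) N"
    using continuous_on_subset lipschitz_on_continuous_on by blast
  obtain b :: 'a where "b \<in> Basis" using nonempty_Basis by blast
  then have "sphere (0::'a) 1 \<noteq> {}" by auto
  then obtain s where s: "norm s = 1" and least: "\<And>y. norm y = 1 \<Longrightarrow> N s \<le> N y"
    using continuous_attains_inf[OF compact_sphere _ cont] by auto
  show thesis
  proof
    show "0 < N s" using s nonneg[of s] zero[of s] by (cases "s = 0") auto
    show "N s * norm x \<le> N x" for x
    proof (cases "x = 0")
      case False
      then have "N s \<le> N ((1 / norm x) *\<^sub>R x)" by (intro least) simp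
      then show ?thesis using False by (simp only: scale) (simp add: field_simps)
    qed (use nonneg[of x] in simp)
  qed
qed

text \<open>Equivalence with the Euclidean norm makes the unit ball bounded; otherwise the supremum
  in the definition of the dual norm would be a default value.\<close>

lemma bdd_above_dual_norm:
  fixes N :: "'a::euclidean_space \<Rightarrow> real"
  assumes "is_norm N"
  shows "bdd_above ((\<lambda>x. x \<bullet> z) ` {x. N x \<le> 1})"
proof -
  obtain c where "0 < c" and c: "\<And>x. c * norm x \<le> N x"
    using is_norm_lower_bound[OF assms] by blast
  have "x \<bullet> z \<le> norm z / c" if "N x \<le> 1" for x
  proof -
    have "norm x \<le> 1 / c"
      using c[of x] that \<open>0 < c\<close> by (simp add: field_simps)
    then have "norm x * norm z \<le> (1 / c) * norm z"
      by (rule mult_right_mono) simp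
    then show ?thesis
      using norm_cauchy_schwarz[of x z] by simp
  qed
  then show ?thesis by (auto simp: bdd_above_def)
qed

lemma dual_norm_nonneg:
  fixes N :: "'a::euclidean_space \<Rightarrow> real"
  assumes "is_norm N"
  shows "0 \<le> dual_norm N z"
proof -
  have "N 0 \<le> 1" using assms by (simp add: is_norm_zero)
  then show ?thesis
    unfolding dual_norm_def
    by (intro cSUP_upper2[OF bdd_above_dual_norm[OF assms], of 0]) auto
qed

lemma inner_le_dual_norm:
  fixes N :: "'a::euclidean_space \<Rightarrow> real"
  assumes "is_norm N"
  shows "x \<bullet> z \<le> N x * dual_norm N z"
proof (cases "x = 0")
  case True
  then show ?thesis using assms by (simp add: is_norm_zero)
next
  case False
  then have pos: "0 < N x" using assms by (metis is_norm_def less_eq_real_def)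
  have "N ((1 / N x) *\<^sub>R x) = \<bar>1 / N x\<bar> * N x"
    using assms unfolding is_norm_def by blast
  then have "N ((1 / N x) *\<^sub>R x) \<le> 1" using pos by simp
  then have "((1 / N x) *\<^sub>R x) \<bullet> z \<le> dual_norm N z"
    unfolding dual_norm_def
    by (intro cSUP_upper[OF _ bdd_above_dual_norm[OF assms]]) auto
  then show ?thesis using pos by (simp add: field_simps)
qed

section \<open>Sampling a smooth function\<close>

text \<open>Adding the parabola \<open>L / 2 * (y - x)\<^sup>2\<close> to the remainder gives a function whose derivative
  has the sign of \<open>y - x\<close>, so its minimum is at \<open>x\<close>.\<close>

lemma smooth_ge_tangent:
  fixes f f' :: "real \<Rightarrow> real"
  assumes deriv: "\<And>x. x \<in> {a..b} \<Longrightarrow> (f has_real_derivative f' x) (at x within {a..b})"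
    and lip: "\<And>x y. x \<in> {a..b} \<Longrightarrow> y \<in> {a..b} \<Longrightarrow> \<bar>f' x - f' y\<bar> \<le> L * \<bar>x - y\<bar>"
    and x: "x \<in> {a..b}" and y: "y \<in> {a..b}"
  shows "f x + f' x * (y - x) - L / 2 * (y - x)\<^sup>2 \<le> f y"
proof -
  define g where "g s = f s - f' x * (s - x) + L / 2 * (s - x)\<^sup>2" for s
  define g' where "g' s = f' s - f' x + L * (s - x)" for s
  have dg: "(g has_real_derivative g' s) (at s within {a..b})" if "s \<in> {a..b}" for s
    unfolding g_def g'_def using deriv[OF that]
    by (auto intro!: derivative_eq_intros simp: field_simps)
  have mvt: "\<exists>s\<in>{c..d}. g d - g c = g' s * (d - c)" if "c \<le> d" "{c..d} \<subseteq> {a..b}" for c d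
  proof (rule mvt_very_simple[OF that(1)])
    fix s assume "c \<le> s" "s \<le> d"
    then have "s \<in> {a..b}" using that by auto
    then show "(g has_derivative (*) (g' s)) (at s within {c..d})"
      using has_field_derivative_subset[OF dg that(2)] by (simp add: has_field_derivative_def)
  qed
  have "g x \<le> g y"
  proof (cases "x \<le> y")
    case True
    then obtain s where s: "s \<in> {x..y}" "g y - g x = g' s * (y - x)"
      using mvt[of x y] x y by auto
    then have "\<bar>f' s - f' x\<bar> \<le> L * (s - x)" using lip[of s x] x y by auto
    then have "0 \<le> g' s * (y - x)" using True unfolding g'_def by (intro mult_nonneg_nonneg) auto
    then show ?thesis using s by simp
  next
    case False
    then obtain s where s: "s \<in> {y..x}" "g x - g y = g' s * (x - y)"
      using mvt[of y x] x y by auto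
    then have "\<bar>f' s - f' x\<bar> \<le> L * (x - s)" using lip[of s x] x y by auto
    then have "g' s * (x - y) \<le> 0" using False unfolding g'_def
      by (intro mult_nonpos_nonneg) (auto simp: algebra_simps)
    then show ?thesis using s by simp
  qed
  then show ?thesis by (simp add: g_def)
qed

text \<open>Averaging the two tangent estimates at \<open>x\<close> with the barycentric weights of \<open>x\<close> cancels the
  linear terms and leaves \<open>L / 2 * t * (1 - t)\<close> times the squared length.\<close>

lemma smooth_le_chord:
  fixes f f' :: "real \<Rightarrow> real"
  assumes deriv: "\<And>x. x \<in> {a..b} \<Longrightarrow> (f has_real_derivative f' x) (at x within {a..b})"
    and lip: "\<And>x y. x \<in> {a..b} \<Longrightarrow> y \<in> {a..b} \<Longrightarrow> \<bar>f' x - f' y\<bar> \<le> L * \<bar>x - y\<bar>"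
    and "0 \<le> L" "a \<le> c" "d \<le> b" "0 \<le> t" "t \<le> 1" "c \<le> d"
  shows "f ((1 - t) * c + t * d) \<le> (1 - t) * f c + t * f d + L / 8 * (d - c)\<^sup>2"
proof -
  define x where "x = (1 - t) * c + t * d"
  have xc: "c - x = - (t * (d - c))" and xd: "d - x = (1 - t) * (d - c)"
    by (simp_all add: x_def algebra_simps)
  have "0 \<le> t * (d - c)" "0 \<le> (1 - t) * (d - c)" using assms by auto
  then have "c \<le> x" "x \<le> d" using xc xd by linarith+
  then have mem: "x \<in> {a..b}" "c \<in> {a..b}" "d \<in> {a..b}" using assms by auto
  have "(1 - t) * (f x + f' x * (c - x) - L / 2 * (c - x)\<^sup>2) \<le> (1 - t) * f c"
    using smooth_ge_tangent[OF deriv lip mem(1,2)] \<open>t \<le> 1\<close> by (intro mult_left_mono) auto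
  moreover have "t * (f x + f' x * (d - x) - L / 2 * (d - x)\<^sup>2) \<le> t * f d"
    using smooth_ge_tangent[OF deriv lip mem(1,3)] \<open>0 \<le> t\<close> by (intro mult_left_mono) auto
  moreover have "(1 - t) * (f x + f' x * (c - x) - L / 2 * (c - x)\<^sup>2)
      + t * (f x + f' x * (d - x) - L / 2 * (d - x)\<^sup>2) = f x - L / 2 * (d - c)\<^sup>2 * (t * (1 - t))"
    unfolding xc xd by algebra
  moreover have "L / 2 * (d - c)\<^sup>2 * (t * (1 - t)) \<le> L / 2 * (d - c)\<^sup>2 * (1 / 4)"
  proof (rule mult_left_mono)
    show "t * (1 - t) \<le> 1 / 4"
      using zero_le_power2[of "t - 1 / 2"] by (simp add: power2_eq_square algebra_simps)
  qed (use \<open>0 \<le> L\<close> in simp)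
  ultimately show ?thesis unfolding x_def by linarith
qed

lemma smooth_le_Max_samples:
  fixes f f' :: "real \<Rightarrow> real"
  assumes deriv: "\<And>x. x \<in> {0..1} \<Longrightarrow> (f has_real_derivative f' x) (at x within {0..1})"
    and lip: "\<And>x y. x \<in> {0..1} \<Longrightarrow> y \<in> {0..1} \<Longrightarrow> \<bar>f' x - f' y\<bar> \<le> L * \<bar>x - y\<bar>"
    and "0 \<le> L" "1 \<le> q" and x: "x \<in> {0..1}"
  shows "f x \<le> Max ((\<lambda>\<nu>. f (real \<nu> / real q)) ` {0..q}) + L / (8 * (real q)\<^sup>2)"
proof -
  let ?m = "Max ((\<lambda>\<nu>. f (real \<nu> / real q)) ` {0..q})"
  have sample: "f (real \<nu> / real q) \<le> ?m" if "\<nu> \<le> q" for \<nu>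
    using that by (intro Max_ge) auto
  have q: "0 < real q" using \<open>1 \<le> q\<close> by simp
  show ?thesis
    \<comment> \<open>At \<open>x = 1\<close> rounding down \<open>x * q\<close> would select a cell to the right of the interval.\<close>
  proof (cases "x = 1")
    case True
    then have "f x \<le> ?m" using sample[of q] q by simp
    then show ?thesis using \<open>0 \<le> L\<close> by (simp add: add_increasing2)
  next
    case False
    define k where "k = nat \<lfloor>x * real q\<rfloor>"
    define t where "t = x * real q - real k"
    have k: "real k \<le> x * real q" "x * real q < real k + 1"
      using x q by (auto simp: k_def)
    have "x * real q < 1 * real q" using x False q by (intro mult_strict_right_mono) auto
    then have "k < q" using k by linarith
    then have kq: "real k + 1 \<le> real q" by linarith
    have t: "0 \<le> t" "t \<le> 1" using k by (auto simp: t_def)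
    let ?c = "real k / real q" and ?d = "real (k + 1) / real q"
    have "(1 - t) * ?c + t * ?d = x" using q by (simp add: t_def field_simps)
    moreover have "?d - ?c = 1 / real q" using q by (simp add: field_simps)
    moreover have "0 \<le> ?c" "?d \<le> 1" "?c \<le> ?d" using q kq by (auto simp: field_simps)
    ultimately have "f x \<le> (1 - t) * f ?c + t * f ?d + L / 8 * (1 / real q)\<^sup>2"
      using smooth_le_chord[OF deriv lip \<open>0 \<le> L\<close>, of ?c ?d t] t by simp
    moreover have "(1 - t) * f ?c \<le> (1 - t) * ?m" "t * f ?d \<le> t * ?m"
      using sample[of k] sample[of "k + 1"] \<open>k < q\<close> t by (auto intro!: mult_left_mono)
    ultimately show ?thesis by (simp add: power_divide algebra_simps)
  qed
qed

lemma smooth_const_nonneg: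
  assumes "is_norm N" "smooth_const N L f"
  shows "0 \<le> L"
proof -
  obtain f' where lip: "\<forall>x\<in>{0..1}. \<forall>y\<in>{0..1}. N (f' x - f' y) \<le> L * \<bar>x - y\<bar>"
    using assms(2) unfolding smooth_const_def by blast
  have "N (f' 1 - f' 0) \<le> L * \<bar>1 - 0\<bar>" by (intro lip[rule_format]) auto
  moreover have "0 \<le> N (f' 1 - f' 0)" using assms(1) by (simp add: is_norm_def)
  ultimately show ?thesis by simp
qed

text \<open>The chord estimate yields \<open>L / (8 q\<^sup>2)\<close>; the radius in use is the coarser \<open>L / (8 q)\<close>.\<close>

lemma smooth_const_le_Max:
  fixes f :: "real \<Rightarrow> 'a::euclidean_space"
  assumes N: "is_norm N" and f: "smooth_const N L f" and "1 \<le> q" "x \<in> {0..1}"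
  shows "f x \<bullet> z \<le> Max ((\<lambda>\<nu>. f (real \<nu> / real q) \<bullet> z) ` {0..q}) + L / (8 * real q) * dual_norm N z"
proof -
  obtain f' where deriv: "\<And>x. x \<in> {0..1} \<Longrightarrow> (f has_vector_derivative f' x) (at x within {0..1})"
    and lip: "\<And>x y. x \<in> {0..1} \<Longrightarrow> y \<in> {0..1} \<Longrightarrow> N (f' x - f' y) \<le> L * \<bar>x - y\<bar>"
    using f unfolding smooth_const_def by blast
  have D: "0 \<le> dual_norm N z" and L: "0 \<le> L"
    using dual_norm_nonneg[OF N] smooth_const_nonneg[OF N f] by auto
  have le: "f' x \<bullet> z - f' y \<bullet> z \<le> L * dual_norm N z * \<bar>x - y\<bar>"
    if "x \<in> {0..1}" "y \<in> {0..1}" for x y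
  proof -
    have "(f' x - f' y) \<bullet> z \<le> N (f' x - f' y) * dual_norm N z"
      by (rule inner_le_dual_norm[OF N])
    also have "\<dots> \<le> L * \<bar>x - y\<bar> * dual_norm N z"
      using lip[OF that] D by (rule mult_right_mono)
    finally show ?thesis by (simp add: inner_diff_left algebra_simps)
  qed
  have "f x \<bullet> z \<le> Max ((\<lambda>\<nu>. f (real \<nu> / real q) \<bullet> z) ` {0..q}) + L * dual_norm N z / (8 * (real q)\<^sup>2)"
  proof (rule smooth_le_Max_samples[where f' = "\<lambda>x. f' x \<bullet> z"])
    show "((\<lambda>x. f x \<bullet> z) has_real_derivative f' y \<bullet> z) (at y within {0..1})" if "y \<in> {0..1}" for y
      using bounded_linear.has_vector_derivative[OF bounded_linear_inner_left deriv[OF that]]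
      by (simp add: has_real_derivative_iff_has_vector_derivative)
    show "\<bar>f' x \<bullet> z - f' y \<bullet> z\<bar> \<le> L * dual_norm N z * \<bar>x - y\<bar>"
      if "x \<in> {0..1}" "y \<in> {0..1}" for x y
      using le[OF that] le[OF that(2,1)] by (simp add: abs_minus_commute abs_le_iff)
  qed (use assms D L in auto)
  also have "L * dual_norm N z / (8 * (real q)\<^sup>2) \<le> L * dual_norm N z / (8 * real q)"
    using D L \<open>1 \<le> q\<close> by (intro divide_left_mono) (auto simp: power2_eq_square)
  finally show ?thesis by simp
qed

section \<open>The partition\<close>

text \<open>The weights \<open>x / (x + y)\<close> and \<open>y / (x + y)\<close> lie in \<open>[0, 1]\<close>, where \<open>w \<le> w\<^sup>\<alpha>\<close>.\<close>

lemma powr_add_le: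
  fixes x y \<alpha> :: real
  assumes "0 \<le> x" "0 \<le> y" "0 < \<alpha>" "\<alpha> \<le> 1"
  shows "(x + y) powr \<alpha> \<le> x powr \<alpha> + y powr \<alpha>"
proof (cases "x + y = 0")
  case True
  then show ?thesis by simp
next
  case False
  define s where "s = x + y"
  have s: "0 < s" using False assms by (simp add: s_def)
  have w: "u / s * s powr \<alpha> \<le> u powr \<alpha>" if "0 \<le> u" "u \<le> s" for u
  proof -
    have "u / s \<le> (u / s) powr \<alpha>"
      using that s assms powr_mono'[of \<alpha> 1 "u / s"] by simp
    then show ?thesis using s that by (simp add: powr_divide field_simps)
  qed
  have "s powr \<alpha> = x / s * s powr \<alpha> + y / s * s powr \<alpha>"
    using s by (simp add: s_def add_divide_distrib[symmetric] distrib_right[symmetric])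
  also have "\<dots> \<le> x powr \<alpha> + y powr \<alpha>"
    using assms by (intro add_mono w) (auto simp: s_def)
  finally show ?thesis by (simp add: s_def)
qed

lemma rho_mono:
  assumes "0 < \<alpha>"
  shows "rho \<alpha> Ns r \<le> rho \<alpha> Ns (r + 1)"
  unfolding rho_def using assms by (intro powr_mono2 divide_right_mono) auto

lemma rho_step_le:
  assumes "0 < \<alpha>" "\<alpha> \<le> 1"
  shows "rho \<alpha> Ns (r + 1) - rho \<alpha> Ns r \<le> (1 / real Ns) powr \<alpha>"
  using powr_add_le[of "real r / real Ns" "1 / real Ns" \<alpha>] assms
  by (simp add: rho_def add_divide_distrib add.commute)

lemma unit_interval_cover:
  fixes \<tau> :: real
  assumes "1 \<le> Ns" "\<tau> \<in> {0..1}"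
  obtains r where "r < Ns" "real r / real Ns \<le> \<tau>" "\<tau> \<le> real (r + 1) / real Ns"
proof (cases "\<tau> = 1")
  case True
  then show thesis using assms by (intro that[of "Ns - 1"]) (auto simp: field_simps of_nat_diff)
next
  case False
  define r where "r = nat \<lfloor>\<tau> * real Ns\<rfloor>"
  have r: "real r \<le> \<tau> * real Ns" "\<tau> * real Ns < real r + 1"
    using assms by (auto simp: r_def)
  have "\<tau> * real Ns < 1 * real Ns" using False assms by (intro mult_strict_right_mono) auto
  then have "r < Ns" using r by linarith
  then show thesis using r assms by (intro that[of r]) (auto simp: field_simps)
qed

section \<open>The gap\<close>

lemma value_le_local_bound:
  fixes f :: "real \<Rightarrow> 'a::euclidean_space" and g :: "real \<Rightarrow> 'b::euclidean_space"
  assumes "0 < \<alpha>" "is_norm Nz" "is_norm Nu" "1 \<le> q" "1 \<le> Ns"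
    and f: "smooth_const Nz (Lsm r) (local_map_sm Ns f r)"
    and g: "smooth_const Nu (Lns r) (local_map_ns \<alpha> Ns g r)"
    and r: "real r / real Ns \<le> \<tau>" "\<tau> \<le> real (r + 1) / real Ns"
  shows "f \<tau> \<bullet> z + g (\<tau> powr \<alpha>) \<bullet> u \<le> local_bound \<alpha> q Ns Nz Nu f g Lsm Lns z u r"
proof -
  define t where "t = \<tau> * real Ns - real r"
  have N: "0 < real Ns" using assms by simp
  have t: "t \<in> {0..1}" using r N by (simp add: t_def field_simps)
  have ft: "local_map_sm Ns f r t = f \<tau>" using N by (simp add: local_map_sm_def t_def)
  have "0 \<le> real r / real Ns" using N by simp
  then have \<tau>: "0 \<le> \<tau>" using r by linarith
  have lo: "rho \<alpha> Ns r \<le> \<tau> powr \<alpha>" and hi: "\<tau> powr \<alpha> \<le> rho \<alpha> Ns (r + 1)"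
    unfolding rho_def using r \<tau> assms by (auto intro!: powr_mono2)
  define d where "d = rho \<alpha> Ns (r + 1) - rho \<alpha> Ns r"
  have "rho \<alpha> Ns r < rho \<alpha> Ns (r + 1)"
    unfolding rho_def using N assms by (intro powr_less_mono2 divide_strict_right_mono) auto
  then have d: "0 < d" by (simp add: d_def)
  define \<theta> where "\<theta> = (\<tau> powr \<alpha> - rho \<alpha> Ns r) / d"
  have \<theta>: "\<theta> \<in> {0..1}" using lo hi d by (auto simp: \<theta>_def d_def)
  have g\<theta>: "local_map_ns \<alpha> Ns g r \<theta> = g (\<tau> powr \<alpha>)"
    unfolding local_map_ns_def d_def[symmetric] using d by (simp add: \<theta>_def)
  show ?thesis
    using smooth_const_le_Max[OF assms(2) f \<open>1 \<le> q\<close> t, of z]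
      smooth_const_le_Max[OF assms(3) g \<open>1 \<le> q\<close> \<theta>, of u]
    unfolding ft g\<theta> local_bound_def by linarith
qed

text \<open>The maximizing sample point \<open>\<rho>\<close> of the nonsmooth part corresponds to the time
  \<open>\<tau> = \<rho> powr (1 / \<alpha>)\<close>. The time at which the smooth part is maximal lies in the same subinterval,
  so it is at distance at most \<open>1 / Ns\<close> from \<open>\<tau>\<close>.\<close>

lemma local_bound_le:
  fixes f :: "real \<Rightarrow> 'a::euclidean_space" and g :: "real \<Rightarrow> 'b::euclidean_space"
  assumes "0 < \<alpha>" "is_norm Nz" "1 \<le> q" "r < Ns" and K: "lipschitz_const Nz K f"
  obtains \<tau> where "\<tau> \<in> {0..1}"
    and "local_bound \<alpha> q Ns Nz Nu f g Lsm Lns z u r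
      \<le> f \<tau> \<bullet> z + g (\<tau> powr \<alpha>) \<bullet> u + K / real Ns * dual_norm Nz z
        + Lsm r / (8 * real q) * dual_norm Nz z + Lns r / (8 * real q) * dual_norm Nu u"
proof -
  have N: "0 < real Ns" and q: "0 < real q" using assms by auto
  have fin: "finite ((\<lambda>\<nu>. F (real \<nu> / real q)) ` {0..q})"
    and ne: "(\<lambda>\<nu>. F (real \<nu> / real q)) ` {0..q} \<noteq> {}" for F :: "real \<Rightarrow> real" by auto
  obtain \<nu> where \<nu>: "\<nu> \<le> q"
    and max_sm: "Max ((\<lambda>\<nu>. local_map_sm Ns f r (real \<nu> / real q) \<bullet> z) ` {0..q})
      = local_map_sm Ns f r (real \<nu> / real q) \<bullet> z"
    using Max_in[OF fin ne, of "\<lambda>t. local_map_sm Ns f r t \<bullet> z"] unfolding image_iff by force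
  obtain \<kappa> where \<kappa>: "\<kappa> \<le> q"
    and max_ns: "Max ((\<lambda>\<nu>. local_map_ns \<alpha> Ns g r (real \<nu> / real q) \<bullet> u) ` {0..q})
      = local_map_ns \<alpha> Ns g r (real \<kappa> / real q) \<bullet> u"
    using Max_in[OF fin ne, of "\<lambda>t. local_map_ns \<alpha> Ns g r t \<bullet> u"] unfolding image_iff by force
  define s where "s = (real r + real \<nu> / real q) / real Ns"
  define \<theta> where "\<theta> = real \<kappa> / real q"
  define \<rho> where "\<rho> = rho \<alpha> Ns r + \<theta> * (rho \<alpha> Ns (r + 1) - rho \<alpha> Ns r)"
  define \<tau> where "\<tau> = \<rho> powr (1 / \<alpha>)"
  have \<theta>: "0 \<le> \<theta>" "\<theta> \<le> 1" using \<kappa> q by (auto simp: \<theta>_def)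
  have step: "0 \<le> rho \<alpha> Ns (r + 1) - rho \<alpha> Ns r" using rho_mono[OF \<open>0 < \<alpha>\<close>] by simp
  have \<rho>: "rho \<alpha> Ns r \<le> \<rho>" "\<rho> \<le> rho \<alpha> Ns (r + 1)"
    using mult_nonneg_nonneg[OF \<theta>(1) step] mult_right_mono[OF \<theta>(2) step] by (auto simp: \<rho>_def)
  have "0 \<le> rho \<alpha> Ns r" by (simp add: rho_def)
  then have \<rho>0: "0 \<le> \<rho>" using \<rho> by linarith
  have inv: "rho \<alpha> Ns k powr (1 / \<alpha>) = real k / real Ns" for k
    using \<open>0 < \<alpha>\<close> N by (simp add: rho_def powr_powr)
  have \<tau>lo: "real r / real Ns \<le> \<tau>"
    unfolding inv[symmetric] \<tau>_def using \<rho> \<open>0 < \<alpha>\<close> \<open>0 \<le> rho \<alpha> Ns r\<close> by (intro powr_mono2) auto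
  have \<tau>hi: "\<tau> \<le> real (r + 1) / real Ns"
    unfolding inv[symmetric] \<tau>_def using \<rho> \<rho>0 \<open>0 < \<alpha>\<close> by (intro powr_mono2) auto
  have slo: "real r / real Ns \<le> s" and shi: "s \<le> real (r + 1) / real Ns"
    unfolding s_def using \<nu> q N by (auto intro!: divide_right_mono simp: field_simps)
  have ends: "0 \<le> real r / real Ns" "real (r + 1) / real Ns \<le> 1"
    using N \<open>r < Ns\<close> by (auto simp: field_simps)
  have mem: "\<tau> \<in> {0..1}" "s \<in> {0..1}"
    unfolding atLeastAtMost_iff using \<tau>lo \<tau>hi slo shi ends by linarith+
  have width: "real (r + 1) / real Ns - real r / real Ns = 1 / real Ns"
    using N by (simp add: field_simps)
  have dist: "\<bar>s - \<tau>\<bar> \<le> 1 / real Ns" using \<tau>lo \<tau>hi slo shi width by linarith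
  have K0: "0 \<le> K"
  proof -
    have "0 \<le> Nz (f 1 - f 0)" using \<open>is_norm Nz\<close> by (simp add: is_norm_def)
    also have "\<dots> \<le> K * \<bar>1 - 0\<bar>"
      by (intro K[unfolded lipschitz_const_def, rule_format]) auto
    finally show ?thesis by simp
  qed
  have "(f s - f \<tau>) \<bullet> z \<le> Nz (f s - f \<tau>) * dual_norm Nz z"
    by (rule inner_le_dual_norm[OF \<open>is_norm Nz\<close>])
  also have "\<dots> \<le> (K * \<bar>s - \<tau>\<bar>) * dual_norm Nz z"
    using K mem dual_norm_nonneg[OF \<open>is_norm Nz\<close>]
    by (intro mult_right_mono) (auto simp: lipschitz_const_def)
  also have "\<dots> \<le> (K * (1 / real Ns)) * dual_norm Nz z"
    using dist K0 dual_norm_nonneg[OF \<open>is_norm Nz\<close>]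
    by (intro mult_right_mono mult_left_mono) auto
  finally have fs: "f s \<bullet> z \<le> f \<tau> \<bullet> z + K / real Ns * dual_norm Nz z"
    by (simp add: inner_diff_left)
  have "\<tau> powr \<alpha> = \<rho>" using \<open>0 < \<alpha>\<close> \<rho>0 by (simp add: \<tau>_def powr_powr)
  then have eqs: "local_map_ns \<alpha> Ns g r (real \<kappa> / real q) = g (\<tau> powr \<alpha>)"
    "local_map_sm Ns f r (real \<nu> / real q) = f s"
    by (simp_all add: local_map_ns_def local_map_sm_def \<rho>_def \<theta>_def s_def)
  show thesis
  proof
    show "\<tau> \<in> {0..1}" by (rule mem)
    show "local_bound \<alpha> q Ns Nz Nu f g Lsm Lns z u r
      \<le> f \<tau> \<bullet> z + g (\<tau> powr \<alpha>) \<bullet> u + K / real Ns * dual_norm Nz z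
        + Lsm r / (8 * real q) * dual_norm Nz z + Lns r / (8 * real q) * dual_norm Nu u"
      using fs unfolding local_bound_def max_sm max_ns eqs by linarith
  qed
qed

text \<open>The \<open>B\<^sub>r\<close> bound every value of the objective from above. This gives the first estimate and
  also makes the supremum finite, so that the second may compare it with a single value.\<close>

theorem gap_bounds:
  fixes f :: "real \<Rightarrow> 'a::euclidean_space" and g fns :: "real \<Rightarrow> 'b::euclidean_space"
  assumes \<alpha>: "0 < \<alpha>" "\<alpha> \<le> 1" and Nz: "is_norm Nz" and Nu: "is_norm Nu"
    and q: "1 \<le> q" and Ns: "1 \<le> Ns"
    and fns: "\<And>\<tau>. fns \<tau> = g (\<tau> powr \<alpha>)"
    and g: "smooth_const Nu L_ns g"
    and K: "lipschitz_const Nz K f"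
    and Lsm: "\<And>r. r < Ns \<Longrightarrow> smooth_const Nz (Lsm r) (local_map_sm Ns f r)"
    and Lsm_le: "\<And>r. r < Ns \<Longrightarrow> Lsm r \<le> L_sm / (real Ns)\<^sup>2"
    and Lns: "\<And>r. r < Ns \<Longrightarrow> smooth_const Nu (Lns r) (local_map_ns \<alpha> Ns g r)"
    and Lns_le: "\<And>r. r < Ns \<Longrightarrow> Lns r \<le> L_ns * (rho \<alpha> Ns (r + 1) - rho \<alpha> Ns r)\<^sup>2"
  shows "0 \<le> gap \<alpha> q Ns Nz Nu f fns g Lsm Lns z u"
    and "gap \<alpha> q Ns Nz Nu f fns g Lsm Lns z u
      \<le> (K / real Ns + L_sm / (8 * real q * (real Ns)\<^sup>2)) * dual_norm Nz z
        + L_ns * dual_norm Nu u / (8 * real q * real Ns powr (2 * \<alpha>))"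
proof -
  let ?B = "local_bound \<alpha> q Ns Nz Nu f g Lsm Lns z u"
  let ?v = "\<lambda>\<tau>. f \<tau> \<bullet> z + fns \<tau> \<bullet> u"
  have below: "?v \<tau> \<le> Max (?B ` {0..<Ns})" if \<tau>: "\<tau> \<in> {0..1}" for \<tau>
  proof -
    obtain r where r: "r < Ns" "real r / real Ns \<le> \<tau>" "\<tau> \<le> real (r + 1) / real Ns"
      using unit_interval_cover[OF Ns \<tau>] by blast
    have "?v \<tau> \<le> ?B r"
      unfolding fns by (rule value_le_local_bound) (use assms r in auto)
    also have "\<dots> \<le> Max (?B ` {0..<Ns})" using r(1) by (intro Max_ge) auto
    finally show ?thesis .
  qed
  then have "exact_lhs f fns z u \<le> Max (?B ` {0..<Ns})"
    unfolding exact_lhs_def by (intro cSUP_least) auto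
  then show "0 \<le> gap \<alpha> q Ns Nz Nu f fns g Lsm Lns z u" by (simp add: gap_def)
  have bdd: "bdd_above (?v ` {0..1})" using below by (rule bdd_aboveI2)
  have "Max (?B ` {0..<Ns}) \<in> ?B ` {0..<Ns}" using Ns by (intro Max_in) auto
  then obtain r where r: "r < Ns" and max: "Max (?B ` {0..<Ns}) = ?B r" by auto
  obtain \<tau> where \<tau>: "\<tau> \<in> {0..1}"
    and B: "?B r \<le> ?v \<tau> + K / real Ns * dual_norm Nz z
        + Lsm r / (8 * real q) * dual_norm Nz z + Lns r / (8 * real q) * dual_norm Nu u"
    unfolding fns using local_bound_le[OF \<alpha>(1) Nz q r K] by blast
  have M: "?v \<tau> \<le> exact_lhs f fns z u"
    unfolding exact_lhs_def by (rule cSUP_upper[OF \<tau> bdd])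
  have "Lsm r / (8 * real q) * dual_norm Nz z
      \<le> (L_sm / (real Ns)\<^sup>2) / (8 * real q) * dual_norm Nz z"
    using Lsm_le[OF r] dual_norm_nonneg[OF Nz] by (intro mult_right_mono divide_right_mono) auto
  moreover have "Lns r / (8 * real q) * dual_norm Nu u
      \<le> (L_ns * (1 / real Ns powr (2 * \<alpha>))) / (8 * real q) * dual_norm Nu u"
  proof -
    have "(rho \<alpha> Ns (r + 1) - rho \<alpha> Ns r)\<^sup>2 \<le> ((1 / real Ns) powr \<alpha>)\<^sup>2"
      using rho_step_le[OF \<alpha>] rho_mono[OF \<alpha>(1)] by (intro power_mono) auto
    also have "\<dots> = 1 / real Ns powr (2 * \<alpha>)"
      by (simp add: powr_divide power_divide power2_eq_square flip: powr_add)
    finally have "Lns r \<le> L_ns * (1 / real Ns powr (2 * \<alpha>))"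
      using Lns_le[OF r] mult_left_mono[OF _ smooth_const_nonneg[OF Nu g]] by fastforce
    then show ?thesis
      using dual_norm_nonneg[OF Nu] by (intro mult_right_mono divide_right_mono) auto
  qed
  ultimately show "gap \<alpha> q Ns Nz Nu f fns g Lsm Lns z u
      \<le> (K / real Ns + L_sm / (8 * real q * (real Ns)\<^sup>2)) * dual_norm Nz z
        + L_ns * dual_norm Nu u / (8 * real q * real Ns powr (2 * \<alpha>))"
    using B M unfolding gap_def max by (simp add: algebra_simps)
qed

theorem theorem1:
  fixes \<alpha> h :: real
    and A :: "real^'n^'n" and B :: "real^'m^'n" and H :: "real^'n^'c" and i :: 'c
    and Nz :: "real^('n + 'l::{finite,linorder} \<times> 'm) \<Rightarrow> real"
    and Nu :: "real^'m \<Rightarrow> real"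
    and z :: "real^('n + 'l \<times> 'm)" and \<Delta>u :: "real^'m"
    and q Ns :: nat
    and L_ns L_sm K_sm :: real
    and Lloc_sm Lloc_ns :: "nat \<Rightarrow> real"
  assumes "0 < \<alpha>" and "\<alpha> \<le> 1" and "0 < h"
    and "is_norm Nz" and "is_norm Nu"
    and "1 \<le> q" and "1 \<le> Ns"
    and "smooth_const Nu L_ns (psi_ns_hat \<alpha> h A B H i)"
    and "smooth_const Nz L_sm (psi_sm \<alpha> h A B H i)"
    and "lipschitz_const Nz K_sm (psi_sm \<alpha> h A B H i)"
    and "\<And>r. r < Ns \<Longrightarrow>
           smooth_const Nz (Lloc_sm r) (local_map_sm Ns (psi_sm \<alpha> h A B H i) r)"
    and "\<And>r. r < Ns \<Longrightarrow> Lloc_sm r \<le> L_sm / (real Ns)\<^sup>2"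
    and "\<And>r. r < Ns \<Longrightarrow>
           smooth_const Nu (Lloc_ns r) (local_map_ns \<alpha> Ns (psi_ns_hat \<alpha> h A B H i) r)"
    and "\<And>r. r < Ns \<Longrightarrow> Lloc_ns r \<le> L_ns * (rho \<alpha> Ns (r + 1) - rho \<alpha> Ns r)\<^sup>2"
  shows "0 \<le> gap \<alpha> q Ns Nz Nu (psi_sm \<alpha> h A B H i) (psi_ns \<alpha> h A B H i)
               (psi_ns_hat \<alpha> h A B H i) Lloc_sm Lloc_ns z \<Delta>u
       \<and> gap \<alpha> q Ns Nz Nu (psi_sm \<alpha> h A B H i) (psi_ns \<alpha> h A B H i)
               (psi_ns_hat \<alpha> h A B H i) Lloc_sm Lloc_ns z \<Delta>u
         \<le> (K_sm / real Ns + L_sm / (8 * real q * (real Ns)\<^sup>2)) * dual_norm Nz z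
           + L_ns * dual_norm Nu \<Delta>u / (8 * real q * real Ns powr (2 * \<alpha>))"
proof -
  have "psi_ns \<alpha> h A B H i \<tau> = psi_ns_hat \<alpha> h A B H i (\<tau> powr \<alpha>)" for \<tau>
    by (simp add: psi_ns_def psi_ns_hat_def)
  from gap_bounds[OF assms(1,2,4-7) this assms(8,10-14)]
  show ?thesis by blast
qed

end
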